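(* There is a function $\varepsilon:\mathbb{N}\to[0,\infty)$ with $\varepsilon(n)\to 0$ as $n\to\infty$ such that for every $n$ and every 2-colouring of the edges of the hypercube $Q_n$, there exist a pair of antipodal vertices of $Q_n$ and a geodesic joining them that has at most $(\frac{3}{8}+\varepsilon(n))n$ colour changes. (That is, in any 2-colouring of the edges of $Q_n$ one can find an antipodal pair joined by a geodesic with at most $(\frac38+o(1))n$ colour changes, the $o(1)$ term depending only on $n$.)
   Context: The hypercube $Q_n$ has vertex set $\{0,1\}^n$, two vertices being adjacent if they differ in exactly one coordinate; the direction of an edge is the coordinate in which its endpoints differ. Two vertices are antipodal if their graph distance is $n$. A geodesic is a path in $Q_n$ no two of whose edges have the same direction. The number of colour changes of a path $(u_0,u_1,\dots,u_m)$ in an edge-coloured graph is the number of indices $1\le i\le m-1$ such that the edges $u_{i-1}u_i$ and $u_iu_{i+1}$ have different colours. *)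

theory Defs
  imports Complex_Main "HOL-Library.Extended_Nat"
begin

text \<open>
  A simple graph is given by a vertex set \<open>V\<close> and a set \<open>E\<close> of two-element edges. A path
  \<open>(u\<^sub>0, \<dots>, u\<^sub>m)\<close> is the list of its \<open>m + 1\<close> vertices; its length is \<open>m\<close>, and \<open>m = 0\<close> is allowed.
\<close>

definition graph_path :: "'a set \<Rightarrow> 'a set set \<Rightarrow> 'a list \<Rightarrow> bool" where
  "graph_path V E p \<longleftrightarrow> p \<noteq> [] \<and> distinct p \<and> set p \<subseteq> V \<and>
     (\<forall>i. Suc i < length p \<longrightarrow> {p ! i, p ! Suc i} \<in> E)"

definition path_joins :: "'a list \<Rightarrow> 'a \<Rightarrow> 'a \<Rightarrow> bool" where
  "path_joins p u v \<longleftrightarrow> hd p = u \<and> last p = v"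

text \<open>The infimum is \<open>\<infinity>\<close> if no path joins the two vertices.\<close>

definition graph_dist :: "'a set \<Rightarrow> 'a set set \<Rightarrow> 'a \<Rightarrow> 'a \<Rightarrow> enat" where
  "graph_dist V E u v = (INF p \<in> {p. graph_path V E p \<and> path_joins p u v}. enat (length p - 1))"

definition colour_changes :: "('a set \<Rightarrow> 'c) \<Rightarrow> 'a list \<Rightarrow> nat" where
  "colour_changes c p =
     card {i. 1 \<le> i \<and> i + 1 < length p \<and> c {p ! (i - 1), p ! i} \<noteq> c {p ! i, p ! (i + 1)}}"

definition cube_verts :: "nat \<Rightarrow> bool list set" where
  "cube_verts n = {x. length x = n}"

definition cube_edges :: "nat \<Rightarrow> bool list set set" where
  "cube_edges n =
     {{x, y} | x y. x \<in> cube_verts n \<and> y \<in> cube_verts n \<and> (\<exists>!i. i < n \<and> x ! i \<noteq> y ! i)}"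

text \<open>Meaningful only for \<open>e \<in> cube_edges n\<close>, where the coordinate is unique.\<close>

definition cube_direction :: "nat \<Rightarrow> bool list set \<Rightarrow> nat" where
  "cube_direction n e = (THE i. i < n \<and> (\<exists>x\<in>e. \<exists>y\<in>e. x ! i \<noteq> y ! i))"

lemma cube_direction_edge:
  assumes "\<exists>!i. i < n \<and> x ! i \<noteq> y ! i" and "j < n" and "x ! j \<noteq> y ! j"
  shows "cube_direction n {x, y} = j"
  unfolding cube_direction_def using assms by (intro the_equality) auto

definition cube_antipodal :: "nat \<Rightarrow> bool list \<Rightarrow> bool list \<Rightarrow> bool" where
  "cube_antipodal n u v \<longleftrightarrow> u \<in> cube_verts n \<and> v \<in> cube_verts n \<and>
     graph_dist (cube_verts n) (cube_edges n) u v = enat n"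

definition cube_geodesic :: "nat \<Rightarrow> bool list list \<Rightarrow> bool" where
  "cube_geodesic n p \<longleftrightarrow> graph_path (cube_verts n) (cube_edges n) p \<and>
     (\<forall>i j. i < j \<and> Suc j < length p \<longrightarrow>
        cube_direction n {p ! i, p ! Suc i} \<noteq> cube_direction n {p ! j, p ! Suc j})"

end

theory Submission
  imports Defs "HOL-Combinatorics.Multiset_Permutations" "HOL-Real_Asymp.Real_Asymp"
begin

text \<open>
  Take a uniformly random antipodal geodesic, cut its direction sequence into segments of
  \<open>2 * L\<close> directions with \<open>L\<close> a large constant, and group each segment into \<open>L\<close> pairs. A pair of
  directions traverses a square, and the two directions may be swapped. Choose the order
  greedily: first minimise the changes inside the square, then the change at the junction
  with the preceding edge. Squares offering two equally good orders with different
  first colours never cost a junction; they only pass the incoming colour on, possibly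
  flipped. All other squares have a forced first colour and, seen in reverse, a forced last colour.

  If forced junctions cost one half on average, a case analysis of the colourings of a
  square, together with the fact that at most half of the pairs of edges at a vertex have different
  colours, bounds the mean cost of a pair of steps by \<open>3 / 4\<close>. For the junctions, let \<open>g y\<close> be the
  mean sign of the forced first colour at \<open>y\<close>. By reversal \<open>g y\<close> is also the mean sign of the
  forced last colour of squares ending at \<open>y\<close>, so the saving over one half is a multiple of the
  inner product of \<open>g\<close> with \<open>\<Sum>j<k. F\<^sup>j g\<close>, where the flexible squares define a self-adjoint
  contraction \<open>F\<close>. It is nonnegative, because \<open>1 + F\<close> is positive semidefinite.

  Replacing random permutations by independent directions inside a segment costs a factor
  \<open>1 + o(1)\<close>, and gluing the segments costs at most \<open>n / (2 * L)\<close> further changes.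
\<close>

subsection \<open>Squares of the cube\<close>

definition flip :: "bool list \<Rightarrow> nat \<Rightarrow> bool list" where
  "flip x i = x[i := \<not> x ! i]"

lemma length_flip [simp]: "length (flip x i) = length x"
  by (simp add: flip_def)

lemma flip_flip [simp]: "flip (flip x i) i = x"
  by (cases "i < length x") (auto simp: flip_def list_update_beyond)

lemma flip_commute: "flip (flip x i) j = flip (flip x j) i"
  by (cases "i = j") (auto simp: flip_def list_update_swap)

lemma flip_in_cube [simp]: "flip x i \<in> cube_verts n \<longleftrightarrow> x \<in> cube_verts n"
  by (simp add: cube_verts_def)

lemma cube_verts_eq_lists: "cube_verts n = {x. set x \<subseteq> UNIV \<and> length x = n}"
  by (auto simp: cube_verts_def)

lemma finite_cube_verts [simp]: "finite (cube_verts n)"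
  unfolding cube_verts_eq_lists by (rule finite_lists_length_eq) simp

lemma card_cube_verts [simp]: "card (cube_verts n) = 2 ^ n"
  unfolding cube_verts_eq_lists by (subst card_lists_length_eq) auto

lemma sum_cube_flip:
  "(\<Sum>x\<in>cube_verts n. f (flip x i)) = (\<Sum>x\<in>cube_verts n. f x)"
  by (rule sum.reindex_bij_witness[where i = "\<lambda>x. flip x i" and j = "\<lambda>x. flip x i"]) auto

definition col :: "(bool list set \<Rightarrow> bool) \<Rightarrow> bool list \<Rightarrow> nat \<Rightarrow> bool" where
  "col c x i = c {x, flip x i}"

lemma col_flip [simp]: "col c (flip x i) i = col c x i"
  by (simp add: col_def insert_commute)

definition sg :: "bool \<Rightarrow> real" where
  "sg b = (if b then 1 else - 1)"

text \<open>
  A square is traversed from a corner to the opposite corner either along edges coloured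
  \<open>p, q\<close> or along edges coloured \<open>p', q'\<close>. The traversal first minimises the colour change
  inside the square, then the colour change with the preceding edge, of colour \<open>z\<close>. If both
  colour patterns are equally good and start with different colours the square is flexible;
  otherwise its first colour is forced. Colours are encoded as signs, so \<open>forced_start\<close> is \<open>0\<close> for
  a flexible square, and \<open>relay\<close> is the factor by which a flexible square multiplies the sign
  of the incoming colour.
\<close>

definition inner_change :: "bool \<Rightarrow> bool \<Rightarrow> bool \<Rightarrow> bool \<Rightarrow> real" where
  "inner_change p q p' q' = (if p \<noteq> q \<and> p' \<noteq> q' then 1 else 0)"

definition forced_start :: "bool \<Rightarrow> bool \<Rightarrow> bool \<Rightarrow> bool \<Rightarrow> real" where
  "forced_start p q p' q' = (if p = p' then sg p else if (p = q) = (p' = q') then 0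
     else if p = q then sg p else sg p')"

definition relay :: "bool \<Rightarrow> bool \<Rightarrow> bool \<Rightarrow> bool \<Rightarrow> real" where
  "relay p q p' q' = (if p \<noteq> p' \<and> (p = q) = (p' = q') then (if p = q then 1 else - 1) else 0)"

definition swaps :: "bool \<Rightarrow> bool \<Rightarrow> bool \<Rightarrow> bool \<Rightarrow> bool \<Rightarrow> bool" where
  "swaps z p q p' q' \<longleftrightarrow> p \<noteq> q \<and> p' = q' \<or> (p = q) = (p' = q') \<and> p \<noteq> z \<and> p' = z"

text \<open>With colours as signs, entering a forced first sign \<open>s\<close> costs
  \<open>(1 - s * sg z) / 2\<close>. A flexible square starts with the colour \<open>z\<close>, and
  its \<open>forced_start\<close> of 0 removes the term. The result is affine in
  \<open>sg z\<close>, a form that survives averaging.\<close>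

lemma swaps_cost:
  "(of_bool (z \<noteq> (if swaps z p q p' q' then p' else p)) +
    of_bool ((if swaps z p q p' q' then p' else p) \<noteq> (if swaps z p q p' q' then q' else q)) :: real) =
   inner_change p q p' q' + (\<bar>forced_start p q p' q'\<bar> - forced_start p q p' q' * sg z) / 2"
  by (cases p; cases q; cases p'; cases q'; cases z)
    (simp_all add: swaps_def inner_change_def forced_start_def sg_def)

text \<open>Read backwards, the square offers the patterns \<open>q', p'\<close> and
  \<open>q, p\<close>, so a forced last colour is the forced first colour of the reversed square. A
  flexible square is flexible in both directions.\<close>

lemma swaps_last:
  "sg (if swaps z p q p' q' then q' else q) = forced_start q' p' q p + relay p q p' q' * sg z"
  by (cases p; cases q; cases p'; cases q'; cases z)
    (simp_all add: swaps_def relay_def forced_start_def sg_def)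

lemma relay_reverse: "relay q' p' q p = relay p q p' q'"
  by (auto simp: relay_def)

lemma abs_relay_le: "\<bar>relay p q p' q'\<bar> \<le> 1"
  by (auto simp: relay_def)

text \<open>The two diagonals have to be added: a square with two adjacent edges of each colour
  costs 3/2 along one and 0 along the other. The indicators on the right mark the corners where two
  colours meet. The bound is strict only if exactly one edge has a colour of its own.\<close>

lemma square_corners:
  "2 * (inner_change p q p' q' + \<bar>forced_start p q p' q'\<bar> / 2 +
    (inner_change p p' q q' + \<bar>forced_start p p' q q'\<bar> / 2)) \<le>
   2 + (of_bool (p \<noteq> p') + of_bool (p \<noteq> q) + of_bool (p' \<noteq> q') + of_bool (q \<noteq> q')) / 2"
  by (cases p; cases q; cases p'; cases q')
    (simp_all add: inner_change_def forced_start_def sg_def)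

definition far :: "bool list \<Rightarrow> nat \<Rightarrow> nat \<Rightarrow> bool list" where
  "far x i j = flip (flip x i) j"

lemma far_in_cube [simp]: "far x i j \<in> cube_verts n \<longleftrightarrow> x \<in> cube_verts n"
  by (simp add: far_def)

lemma far_far [simp]: "far (far x i j) i j = x"
  by (metis far_def flip_commute flip_flip)

lemma sum_cube_far:
  "(\<Sum>x\<in>cube_verts n. f (far x i j)) = (\<Sum>x\<in>cube_verts n. f x)"
  by (rule sum.reindex_bij_witness[where i = "\<lambda>x. far x i j" and j = "\<lambda>x. far x i j"]) auto

definition square ::
  "(bool list set \<Rightarrow> bool) \<Rightarrow> (bool \<Rightarrow> bool \<Rightarrow> bool \<Rightarrow> bool \<Rightarrow> 'r) \<Rightarrow> bool list \<Rightarrow> nat \<Rightarrow> nat \<Rightarrow> 'r" where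
  "square c f x i j = f (col c x i) (col c (flip x i) j) (col c x j) (col c (flip x j) i)"

lemma square_far: "square c f (far x i j) i j = square c (\<lambda>p q p' q'. f q' p' q p) x i j"
proof -
  have 1: "far x i j = flip (flip x j) i" "far x i j = flip (flip x i) j"
    by (simp_all add: far_def flip_commute)
  have "col c (far x i j) i = col c (flip x j) i" "col c (far x i j) j = col c (flip x i) j"
    "flip (far x i j) i = flip x j" "flip (far x i j) j = flip x i"
    by (simp add: 1(1)) (simp add: 1(2), simp add: 1(1), simp add: 1(2))
  then show ?thesis by (simp add: square_def)
qed

lemma square_flip: "square c f (flip x i) i j = square c (\<lambda>p q p' q'. f p p' q q') x i j"
  using flip_commute[of x i j] by (simp add: square_def)

text \<open>
  Directions are drawn with replacement. A degenerate block \<open>i = j\<close> costs nothing and passes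
  the colour on, which is compatible with reversal.
\<close>

definition inner_at :: "(bool list set \<Rightarrow> bool) \<Rightarrow> bool list \<Rightarrow> nat \<Rightarrow> nat \<Rightarrow> real" where
  "inner_at c x i j = (if i = j then 0 else square c inner_change x i j)"

definition start_at :: "(bool list set \<Rightarrow> bool) \<Rightarrow> bool list \<Rightarrow> nat \<Rightarrow> nat \<Rightarrow> real" where
  "start_at c x i j = (if i = j then 0 else square c forced_start x i j)"

definition end_at :: "(bool list set \<Rightarrow> bool) \<Rightarrow> bool list \<Rightarrow> nat \<Rightarrow> nat \<Rightarrow> real" where
  "end_at c x i j = (if i = j then 0 else square c (\<lambda>p q p' q'. forced_start q' p' q p) x i j)"

definition relay_at :: "(bool list set \<Rightarrow> bool) \<Rightarrow> bool list \<Rightarrow> nat \<Rightarrow> nat \<Rightarrow> real" where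
  "relay_at c x i j = (if i = j then 1 else square c relay x i j)"

lemma start_at_far: "start_at c (far x i j) i j = end_at c x i j"
  by (simp add: start_at_def end_at_def square_far)

lemma relay_at_far: "relay_at c (far x i j) i j = relay_at c x i j"
  by (simp add: relay_at_def square_far relay_reverse)

lemma abs_relay_at_le: "\<bar>relay_at c x i j\<bar> \<le> 1"
  by (simp add: relay_at_def square_def abs_relay_le)

definition step_cost :: "(bool list set \<Rightarrow> bool) \<Rightarrow> bool list \<Rightarrow> bool \<Rightarrow> nat \<Rightarrow> nat \<Rightarrow> real" where
  "step_cost c x z i j = inner_at c x i j + (\<bar>start_at c x i j\<bar> - start_at c x i j * sg z) / 2"

definition step_last :: "(bool list set \<Rightarrow> bool) \<Rightarrow> bool list \<Rightarrow> bool \<Rightarrow> nat \<Rightarrow> nat \<Rightarrow> bool" where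
  "step_last c x z i j = (if i = j then z
     else if square c (swaps z) x i j then col c (flip x j) i else col c (flip x i) j)"

lemma sg_step_last: "sg (step_last c x z i j) = end_at c x i j + relay_at c x i j * sg z"
  using swaps_last[of z "col c x i" "col c (flip x i) j" "col c x j" "col c (flip x j) i"]
  by (auto simp: step_last_def end_at_def relay_at_def square_def split: if_splits)

lemma step_cost_nonneg: "0 \<le> step_cost c x z i j"
proof -
  have "\<bar>start_at c x i j * sg z\<bar> = \<bar>start_at c x i j\<bar>" by (auto simp: sg_def)
  then have "start_at c x i j * sg z \<le> \<bar>start_at c x i j\<bar>" by linarith
  moreover have "0 \<le> inner_at c x i j" by (auto simp: inner_at_def square_def inner_change_def)
  ultimately show ?thesis by (simp add: step_cost_def)
qed

fun block_cost :: "(bool list set \<Rightarrow> bool) \<Rightarrow> bool list \<Rightarrow> bool \<Rightarrow> nat list \<Rightarrow> real" where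
  "block_cost c x z (i # j # w) =
     step_cost c x z i j + block_cost c (far x i j) (step_last c x z i j) w"
| "block_cost c x z w = 0"

lemma block_cost_nonneg: "0 \<le> block_cost c x z w"
  by (induction c x z w rule: block_cost.induct) (auto intro: add_nonneg_nonneg step_cost_nonneg)

text \<open>With \<open>s\<close> the sum of the signs, the count is
  \<open>(n^2 - s^2) / 2\<close>.\<close>

lemma sum_colour_diff:
  fixes b :: "nat \<Rightarrow> bool"
  shows "(\<Sum>i<n. \<Sum>j<n. of_bool (b i \<noteq> b j)) \<le> real n ^ 2 / 2"
proof -
  let ?s = "\<Sum>i<n. sg (b i)"
  have "(\<Sum>i<n. \<Sum>j<n. of_bool (b i \<noteq> b j)) = (\<Sum>i<n. \<Sum>j<n. (1 - sg (b i) * sg (b j)) / 2)"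
    by (intro sum.cong refl) (auto simp: sg_def)
  also have "\<dots> = (real n ^ 2 - ?s ^ 2) / 2"
    by (simp add: sum_divide_distrib[symmetric] sum_subtractf sum_product power2_eq_square)
  finally show ?thesis by simp
qed

lemma sum_square_cost:
  "(\<Sum>x\<in>cube_verts n. \<Sum>i<n. \<Sum>j<n. inner_at c x i j + \<bar>start_at c x i j\<bar> / 2) \<le>
   3 / 4 * real n ^ 2 * 2 ^ n"
proof -
  \<comment> \<open>The square is charged from both of its diagonals, so that all four corners enter.\<close>
  define H where "H x i j = inner_at c x i j + \<bar>start_at c x i j\<bar> / 2" for x i j
  define D :: "bool list \<Rightarrow> nat \<Rightarrow> nat \<Rightarrow> real" where "D x i j = of_bool (col c x i \<noteq> col c x j)" for x i j
  have pt: "2 * (H x i j + H (flip x i) i j) \<le>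
      2 + (D x i j + D (flip x i) i j + D (flip x j) i j + D (far x i j) i j) / 2" for x i j
  proof (cases "i = j")
    case True
    then show ?thesis by (simp add: H_def D_def inner_at_def start_at_def)
  next
    case False
    have d: "D (flip x i) i j = of_bool (col c x i \<noteq> col c (flip x i) j)"
      "D (flip x j) i j = of_bool (col c x j \<noteq> col c (flip x j) i)"
      by (auto simp: D_def)
    have e: "D (far x i j) i j = of_bool (col c (flip x i) j \<noteq> col c (flip x j) i)"
      using flip_commute[of x i j] by (auto simp: D_def far_def) (metis col_flip)+
    have h: "H x i j = square c (\<lambda>p q p' q'. inner_change p q p' q' + \<bar>forced_start p q p' q'\<bar> / 2) x i j" for x
      using False by (simp add: H_def inner_at_def start_at_def square_def)
    show ?thesis
      unfolding d e h square_flip unfolding square_def D_def by (rule square_corners)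
  qed
  \<comment> \<open>Summed over the cube, all corners of a square contribute equally, so division by
    4 leaves \<open>1 / 2 + D / 2\<close>. Since \<open>D\<close> is at most 1/2 on average, the
    constant becomes 3/4.\<close>
  have pair: "(\<Sum>x\<in>cube_verts n. H x i j) \<le> (\<Sum>x\<in>cube_verts n. 1 / 2 + D x i j / 2)" for i j
  proof -
    have "4 * (\<Sum>x\<in>cube_verts n. H x i j) = (\<Sum>x\<in>cube_verts n. 2 * (H x i j + H (flip x i) i j))"
      using sum_cube_flip[of "\<lambda>x. H x i j" i n]
      by (simp add: sum.distrib sum_distrib_left[symmetric])
    also have "\<dots> \<le> (\<Sum>x\<in>cube_verts n.
        2 + (D x i j + D (flip x i) i j + D (flip x j) i j + D (far x i j) i j) / 2)"
      by (intro sum_mono pt)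
    also have "\<dots> = 4 * (\<Sum>x\<in>cube_verts n. 1 / 2 + D x i j / 2)"
      using sum_cube_flip[of "\<lambda>x. D x i j" i n] sum_cube_flip[of "\<lambda>x. D x i j" j n]
        sum_cube_far[of "\<lambda>x. D x i j" i j n]
      by (simp add: sum.distrib sum_divide_distrib[symmetric])
    finally show ?thesis by simp
  qed
  have "(\<Sum>x\<in>cube_verts n. \<Sum>i<n. \<Sum>j<n. H x i j) = (\<Sum>i<n. \<Sum>j<n. \<Sum>x\<in>cube_verts n. H x i j)"
    by (subst sum.swap, intro sum.cong refl, rule sum.swap)
  also have "\<dots> \<le> (\<Sum>i<n. \<Sum>j<n. \<Sum>x\<in>cube_verts n. 1 / 2 + D x i j / 2)"
    by (intro sum_mono pair)
  also have "\<dots> = (\<Sum>x\<in>cube_verts n. \<Sum>i<n. \<Sum>j<n. 1 / 2 + D x i j / 2)"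
    by (subst (2) sum.swap, intro sum.cong refl, rule sum.swap)
  also have "\<dots> = (\<Sum>x\<in>cube_verts n. real n ^ 2 / 2 + (\<Sum>i<n. \<Sum>j<n. D x i j) / 2)"
    by (simp add: sum.distrib sum_divide_distrib[symmetric] power2_eq_square)
  also have "\<dots> \<le> (\<Sum>x\<in>cube_verts n. real n ^ 2 / 2 + (real n ^ 2 / 2) / 2)"
    unfolding D_def by (intro sum_mono add_left_mono divide_right_mono sum_colour_diff) simp
  also have "\<dots> = 3 / 4 * real n ^ 2 * 2 ^ n"
    by simp
  finally show ?thesis by (simp add: H_def)
qed

subsection \<open>The mean cost of a random sequence of squares\<close>

definition avg :: "nat \<Rightarrow> (nat \<Rightarrow> nat \<Rightarrow> real) \<Rightarrow> real" where
  "avg n f = (\<Sum>i<n. \<Sum>j<n. f i j) / real n ^ 2"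

lemma avg_add: "avg n (\<lambda>i j. f i j + g i j) = avg n f + avg n g"
  by (simp add: avg_def sum.distrib add_divide_distrib)

lemma avg_cmult: "avg n (\<lambda>i j. a * f i j) = a * avg n f"
  by (simp add: avg_def sum_distrib_left)

lemma avg_const: "n > 0 \<Longrightarrow> avg n (\<lambda>i j. a) = a"
  by (simp add: avg_def power2_eq_square)

lemma sum_avg: "(\<Sum>x\<in>X. avg n (f x)) = avg n (\<lambda>i j. \<Sum>x\<in>X. f x i j)"
proof -
  have "(\<Sum>x\<in>X. \<Sum>i<n. \<Sum>j<n. f x i j) = (\<Sum>i<n. \<Sum>j<n. \<Sum>x\<in>X. f x i j)"
    by (subst sum.swap, intro sum.cong refl, rule sum.swap)
  then show ?thesis by (simp add: avg_def sum_divide_distrib[symmetric])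
qed

section \<open>The transfer operator of the flexible squares and its positivity\<close>

definition transfer ::
  "(bool list set \<Rightarrow> bool) \<Rightarrow> nat \<Rightarrow> (bool list \<Rightarrow> real) \<Rightarrow> bool list \<Rightarrow> real" where
  "transfer c n h x = avg n (\<lambda>i j. relay_at c x i j * h (far x i j))"

lemma transfer_add:
  "transfer c n (\<lambda>x. h x + k x) = (\<lambda>x. transfer c n h x + transfer c n k x)"
  by (simp add: transfer_def avg_add distrib_left fun_eq_iff)

text \<open>For fixed directions \<open>far\<close> is an involution and \<open>relay_at\<close>
  agrees at its two ends, so each operator in the average is symmetric.\<close>

lemma transfer_self_adjoint:
  "(\<Sum>x\<in>cube_verts n. h x * transfer c n k x) = (\<Sum>x\<in>cube_verts n. transfer c n h x * k x)"
proof -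
  have "(\<Sum>x\<in>cube_verts n. h x * (relay_at c x i j * k (far x i j))) =
      (\<Sum>x\<in>cube_verts n. k x * (relay_at c x i j * h (far x i j)))" for i j
    using sum_cube_far[of "\<lambda>x. k x * (relay_at c x i j * h (far x i j))" i j n]
    by (simp add: relay_at_far mult_ac)
  then show ?thesis
    unfolding transfer_def mult.commute[of "avg n _"] avg_cmult[symmetric] sum_avg by simp
qed

text \<open>For fixed directions the squares \<open>h x ^ 2\<close> can be shared between the two
  ends of a diagonal, and the factor \<open>relay_at\<close> of modulus at most 1 leaves at least
  \<open>a^2 + b^2 - 2 * |a * b|\<close>. Hence \<open>1 + transfer\<close> is positive
  semidefinite.\<close>

lemma transfer_contraction:
  assumes "n > 0"
  shows "0 \<le> (\<Sum>x\<in>cube_verts n. h x * (h x + transfer c n h x))"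
proof -
  have "0 \<le> (\<Sum>x\<in>cube_verts n. h x * (h x + relay_at c x i j * h (far x i j)))" for i j
  proof -
    have pt: "0 \<le> h x ^ 2 + h (far x i j) ^ 2 + 2 * (relay_at c x i j * (h x * h (far x i j)))" for x
    proof -
      have "\<bar>relay_at c x i j * (h x * h (far x i j))\<bar> \<le> 1 * \<bar>h x * h (far x i j)\<bar>"
        unfolding abs_mult[of "relay_at c x i j"] by (intro mult_right_mono abs_relay_at_le) simp
      moreover have "2 * \<bar>h x * h (far x i j)\<bar> \<le> h x ^ 2 + h (far x i j) ^ 2"
        using sum_squares_bound[of "\<bar>h x\<bar>" "\<bar>h (far x i j)\<bar>"] by (simp add: abs_mult)
      ultimately show ?thesis by linarith
    qed
    have "2 * (\<Sum>x\<in>cube_verts n. h x * (h x + relay_at c x i j * h (far x i j))) =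
        (\<Sum>x\<in>cube_verts n. h x ^ 2) + (\<Sum>x\<in>cube_verts n. h x ^ 2) +
        (\<Sum>x\<in>cube_verts n. 2 * (relay_at c x i j * (h x * h (far x i j))))"
      by (simp add: sum.distrib sum_distrib_left power2_eq_square algebra_simps)
    also have "\<dots> = (\<Sum>x\<in>cube_verts n. h x ^ 2) + (\<Sum>x\<in>cube_verts n. h (far x i j) ^ 2) +
        (\<Sum>x\<in>cube_verts n. 2 * (relay_at c x i j * (h x * h (far x i j))))"
      using sum_cube_far[of "\<lambda>x. h x ^ 2" i j n] by simp
    also have "\<dots> = (\<Sum>x\<in>cube_verts n. h x ^ 2 + h (far x i j) ^ 2 +
        2 * (relay_at c x i j * (h x * h (far x i j))))"
      by (simp add: sum.distrib)
    also have "\<dots> \<ge> 0" by (intro sum_nonneg pt)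
    finally show ?thesis by simp
  qed
  then have "0 \<le> avg n (\<lambda>i j. \<Sum>x\<in>cube_verts n. h x * (h x + relay_at c x i j * h (far x i j)))"
    by (simp add: avg_def sum_nonneg)
  also have "\<dots> = (\<Sum>x\<in>cube_verts n. h x * (h x + transfer c n h x))"
    using assms by (simp add: sum_avg[symmetric] avg_cmult avg_add avg_const transfer_def)
  finally show ?thesis .
qed

text \<open>Horner form of the partial Neumann sum, matching the removal of the first block of a
  word.\<close>

primrec neumann ::
  "(bool list set \<Rightarrow> bool) \<Rightarrow> nat \<Rightarrow> (bool list \<Rightarrow> real) \<Rightarrow> nat \<Rightarrow> bool list \<Rightarrow> real" where
  "neumann c n h 0 x = 0"
| "neumann c n h (Suc k) x = h x + transfer c n (neumann c n h k) x"

text \<open>Both sides are the same polynomial in \<open>transfer\<close> applied to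
  \<open>h\<close>.\<close>

lemma transfer_neumann: "transfer c n (neumann c n h k) = neumann c n (transfer c n h) k"
proof (induction k)
  case 0
  have "neumann c n h' 0 = (\<lambda>x. 0)" for h' by auto
  then show ?case by (simp add: transfer_def avg_def fun_eq_iff)
next
  case (Suc k)
  have "neumann c n h' (Suc k) = (\<lambda>x. h' x + transfer c n (neumann c n h' k) x)" for h' by auto
  with Suc show ?case by (simp add: transfer_add)
qed

text \<open>
  Consecutive terms of the Neumann series \<open>\<Sum>j<k. transfer\<^sup>j h\<close> are paired: with
  \<open>h' = transfer\<^sup>i h\<close> the terms \<open>2 * i\<close> and \<open>2 * i + 1\<close> contribute the inner_change product of
  \<open>h'\<close> with \<open>h' + transfer h'\<close>.
\<close>

lemma neumann_nonneg:
  assumes "n > 0"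
  shows "0 \<le> (\<Sum>x\<in>cube_verts n. h x * neumann c n h k x)"
proof (induction k arbitrary: h rule: induct_nat_012)
  case 1
  have "transfer c n (\<lambda>x. 0) = (\<lambda>x. 0)" by (simp add: transfer_def avg_def fun_eq_iff)
  moreover have "neumann c n h 0 = (\<lambda>x. 0)" by auto
  ultimately show ?case by (auto intro: sum_nonneg)
next
  case (ge2 k)
  let ?F = "transfer c n"
  have "neumann c n h (Suc (Suc k)) x = h x + ?F h x + ?F (?F (neumann c n h k)) x" for x
  proof -
    have "neumann c n h (Suc k) = (\<lambda>x. h x + ?F (neumann c n h k) x)" by auto
    then show ?thesis by (simp only: neumann.simps transfer_add add.assoc)
  qed
  then have "(\<Sum>x\<in>cube_verts n. h x * neumann c n h (Suc (Suc k)) x) =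
      (\<Sum>x\<in>cube_verts n. h x * (h x + ?F h x)) +
      (\<Sum>x\<in>cube_verts n. h x * ?F (?F (neumann c n h k)) x)"
    by (simp add: sum.distrib[symmetric] distrib_left add.assoc)
  \<comment> \<open>One \<open>transfer\<close> moves to the left by self-adjointness, the other
    passes through the Neumann sum; the induction hypothesis then applies to
    \<open>?F h\<close>.\<close>
  also have "(\<Sum>x\<in>cube_verts n. h x * ?F (?F (neumann c n h k)) x) =
      (\<Sum>x\<in>cube_verts n. ?F h x * neumann c n (?F h) k x)"
    by (subst transfer_self_adjoint) (simp only: transfer_neumann)
  finally show ?case
    using transfer_contraction[OF assms, of h c] ge2(1)[of "?F h"] by simp
qed simp

definition start_bias :: "(bool list set \<Rightarrow> bool) \<Rightarrow> nat \<Rightarrow> bool list \<Rightarrow> real" where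
  "start_bias c n x = avg n (start_at c x)"

text \<open>Substituting \<open>far x i j\<close> for \<open>x\<close> reverses every square. This
  turns the junction term into an inner product of \<open>start_bias\<close> with its own Neumann
  sum.\<close>

lemma sum_end_at_eq:
  "(\<Sum>x\<in>cube_verts n. avg n (\<lambda>i j. end_at c x i j * h (far x i j))) =
   (\<Sum>x\<in>cube_verts n. start_bias c n x * h x)"
proof -
  have "(\<Sum>x\<in>cube_verts n. end_at c x i j * h (far x i j)) =
      (\<Sum>x\<in>cube_verts n. start_at c x i j * h x)" for i j
    using sum_cube_far[of "\<lambda>x. start_at c x i j * h x" i j n] by (simp add: start_at_far)
  then show ?thesis
    unfolding start_bias_def mult.commute[of "avg n _"] avg_cmult[symmetric] sum_avg
    by (simp add: mult.commute)
qed

text \<open>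
  The constant term of the averaged block cost, which is affine in the sign of the incoming
  colour; the other coefficient is minus half a Neumann sum.
\<close>

primrec mean_cost :: "(bool list set \<Rightarrow> bool) \<Rightarrow> nat \<Rightarrow> nat \<Rightarrow> bool list \<Rightarrow> real" where
  "mean_cost c n 0 x = 0"
| "mean_cost c n (Suc k) x = avg n (\<lambda>i j. inner_at c x i j + \<bar>start_at c x i j\<bar> / 2 +
     mean_cost c n k (far x i j) -
     end_at c x i j * neumann c n (start_bias c n) k (far x i j) / 2)"

text \<open>A uniform vertex stays uniform after a block, so each block adds at most 3/4 on average.
  The junction corrections are \<open>- 1 / 2\<close> times the sum in \<open>neumann_nonneg\<close>
  and only lower the total.\<close>

lemma sum_mean_cost_le:
  assumes "n > 0"
  shows "(\<Sum>x\<in>cube_verts n. mean_cost c n k x) \<le> 3 / 4 * real k * 2 ^ n"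
proof (induction k)
  case (Suc k)
  let ?U = "neumann c n (start_bias c n) k"
  let ?H = "\<lambda>x i j. inner_at c x i j + \<bar>start_at c x i j\<bar> / 2"
  have split: "mean_cost c n (Suc k) x = avg n (?H x) + avg n (\<lambda>i j. mean_cost c n k (far x i j)) +
      (- 1 / 2) * avg n (\<lambda>i j. end_at c x i j * ?U (far x i j))" for x
    unfolding avg_add[symmetric] avg_cmult[symmetric] mean_cost.simps
    by (rule arg_cong[where f = "avg n"]) (simp add: fun_eq_iff)
  have "(\<Sum>x\<in>cube_verts n. mean_cost c n (Suc k) x) =
      (\<Sum>x\<in>cube_verts n. avg n (?H x)) +
      (\<Sum>x\<in>cube_verts n. avg n (\<lambda>i j. mean_cost c n k (far x i j))) +
      (- 1 / 2) * (\<Sum>x\<in>cube_verts n. avg n (\<lambda>i j. end_at c x i j * ?U (far x i j)))"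
    unfolding split sum.distrib sum_distrib_left ..
  also have "(\<Sum>x\<in>cube_verts n. avg n (?H x)) \<le> 3 / 4 * 2 ^ n"
    using sum_square_cost[where c = c and n = n] assms
    by (simp add: avg_def sum_divide_distrib[symmetric] field_simps)
  also have "(\<Sum>x\<in>cube_verts n. avg n (\<lambda>i j. mean_cost c n k (far x i j))) =
      (\<Sum>x\<in>cube_verts n. mean_cost c n k x)"
    using assms by (simp add: sum_avg sum_cube_far avg_const)
  also have "(\<Sum>x\<in>cube_verts n. mean_cost c n k x) \<le> 3 / 4 * real k * 2 ^ n"
    by (rule Suc)
  finally show ?case
    using neumann_nonneg[OF assms, where h = "start_bias c n" and c = c and k = k]
    by (simp add: sum_end_at_eq algebra_simps)
qed simp

section \<open>Sums over words of directions drawn with replacement\<close>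

definition words :: "nat \<Rightarrow> nat \<Rightarrow> nat list set" where
  "words n k = {w. set w \<subseteq> {..<n} \<and> length w = k}"

lemma finite_words [simp]: "finite (words n k)"
  unfolding words_def by (rule finite_lists_length_eq) simp

lemma card_words: "card (words n k) = n ^ k"
  unfolding words_def by (subst card_lists_length_eq) auto

lemma sum_words_Suc:
  "(\<Sum>w\<in>words n (Suc k). f w) = (\<Sum>i<n. \<Sum>w\<in>words n k. f (i # w))"
  unfolding sum.cartesian_product
  by (rule sum.reindex_bij_witness[where j = "\<lambda>w. (hd w, tl w)" and i = "\<lambda>(i, w). i # w"])
    (auto simp: words_def length_Suc_conv)

text \<open>The cost of the first block and the sign of its last colour are both affine in
  \<open>sg z\<close>, so affinity passes through the induction. The two coefficients satisfy the
  recursions of \<open>mean_cost\<close> and \<open>neumann\<close>.\<close>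

lemma sum_words_block_cost:
  assumes "n > 0"
  shows "(\<Sum>w\<in>words n (2 * k). block_cost c x z w) =
    real n ^ (2 * k) * (mean_cost c n k x - neumann c n (start_bias c n) k x / 2 * sg z)"
proof (induction k arbitrary: x z)
  case 0
  then show ?case by (simp add: words_def)
next
  case (Suc k)
  let ?U = "neumann c n (start_bias c n)"
  have "(\<Sum>w\<in>words n (2 * Suc k). block_cost c x z w) =
      (\<Sum>i<n. \<Sum>j<n. \<Sum>w\<in>words n (2 * k).
        step_cost c x z i j + block_cost c (far x i j) (step_last c x z i j) w)"
    by (simp add: sum_words_Suc)
  also have "\<dots> = (\<Sum>i<n. \<Sum>j<n. real n ^ (2 * k) * (step_cost c x z i j +
        (mean_cost c n k (far x i j) - ?U k (far x i j) / 2 * sg (step_last c x z i j))))"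
    by (simp add: sum.distrib Suc.IH card_words distrib_left)
  also have "\<dots> = real n ^ (2 * Suc k) * avg n (\<lambda>i j. step_cost c x z i j +
        (mean_cost c n k (far x i j) - ?U k (far x i j) / 2 * sg (step_last c x z i j)))"
    using assms by (simp add: avg_def sum_distrib_left[symmetric] power2_eq_square)
  also have "avg n (\<lambda>i j. step_cost c x z i j +
        (mean_cost c n k (far x i j) - ?U k (far x i j) / 2 * sg (step_last c x z i j))) =
      avg n (\<lambda>i j. (inner_at c x i j + \<bar>start_at c x i j\<bar> / 2 + mean_cost c n k (far x i j) -
          end_at c x i j * ?U k (far x i j) / 2) +
        (- sg z / 2) * (start_at c x i j + relay_at c x i j * ?U k (far x i j)))"
    by (rule arg_cong[where f = "avg n"], intro ext)
      (simp add: step_cost_def sg_step_last field_simps)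
  also have "\<dots> = mean_cost c n (Suc k) x - ?U (Suc k) x / 2 * sg z"
    unfolding avg_add avg_cmult by (simp add: avg_add transfer_def start_bias_def)
  finally show ?case .
qed

text \<open>Adding both incoming colours cancels the \<open>sg z\<close> term and leaves twice the
  mean cost.\<close>

lemma sum_block_cost_le:
  assumes "n > 0"
  shows "(\<Sum>x\<in>cube_verts n. \<Sum>w\<in>words n (2 * k). block_cost c x True w + block_cost c x False w) \<le>
    3 / 2 * real k * 2 ^ n * real n ^ (2 * k)"
proof -
  have "(\<Sum>x\<in>cube_verts n. \<Sum>w\<in>words n (2 * k). block_cost c x True w + block_cost c x False w) =
      2 * real n ^ (2 * k) * (\<Sum>x\<in>cube_verts n. mean_cost c n k x)"
    unfolding sum.distrib[where A = "words n (2 * k)"] sum_words_block_cost[OF assms] sum_distrib_left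
    by (intro sum.cong refl) (simp add: sg_def algebra_simps)
  also have "\<dots> \<le> 2 * real n ^ (2 * k) * (3 / 4 * real k * 2 ^ n)"
    by (intro mult_left_mono sum_mean_cost_le assms) simp
  finally show ?thesis by (simp add: algebra_simps)
qed

subsection \<open>Reordering a direction sequence\<close>

fun chg :: "'a list \<Rightarrow> nat" where
  "chg (a # b # xs) = of_bool (a \<noteq> b) + chg (b # xs)"
| "chg xs = 0"

lemma chg_append_le: "chg (xs @ ys) \<le> chg xs + chg ys + 1"
proof (induction xs rule: chg.induct)
  case ("2_2" a)
  then show ?case by (cases ys) auto
qed auto

lemma chg_le_Cons: "chg xs \<le> chg (z # xs)"
  by (cases xs) auto

lemma chg_le_length: "chg xs \<le> length xs"
  by (induction xs rule: chg.induct) auto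

lemma chg_eq_card: "chg xs = card {k. Suc k < length xs \<and> xs ! k \<noteq> xs ! Suc k}"
proof (induction xs rule: chg.induct)
  case (1 a b xs)
  let ?S = "{k. Suc k < length (b # xs) \<and> (b # xs) ! k \<noteq> (b # xs) ! Suc k}"
  have "finite ?S" by (rule finite_subset[of _ "{..<length (b # xs)}"]) auto
  moreover have "{k. Suc k < length (a # b # xs) \<and> (a # b # xs) ! k \<noteq> (a # b # xs) ! Suc k} =
      (if a \<noteq> b then {0} else {}) \<union> Suc ` ?S"
  proof (rule set_eqI)
    fix k
    show "k \<in> {k. Suc k < length (a # b # xs) \<and> (a # b # xs) ! k \<noteq> (a # b # xs) ! Suc k} \<longleftrightarrow>
        k \<in> (if a \<noteq> b then {0} else {}) \<union> Suc ` ?S"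
      by (cases k) auto
  qed
  ultimately show ?case using 1 by (simp add: card_image)
qed auto

primrec cols :: "(bool list set \<Rightarrow> bool) \<Rightarrow> bool list \<Rightarrow> nat list \<Rightarrow> bool list" where
  "cols c x [] = []"
| "cols c x (i # w) = col c x i # cols c (flip x i) w"

definition move :: "bool list \<Rightarrow> nat list \<Rightarrow> bool list" where
  "move x w = fold (\<lambda>i y. flip y i) w x"

lemma move_simps [simp]: "move x [] = x" "move x (i # w) = move (flip x i) w"
  by (simp_all add: move_def)

lemma move_append: "move x (u @ v) = move (move x u) v"
  by (simp add: move_def)

lemma move_mset: "mset u = mset v \<Longrightarrow> move x u = move x v"
  unfolding move_def
  by (rule fun_cong[OF fold_multiset_equiv]) (auto simp: fun_eq_iff flip_commute)

lemma length_move [simp]: "length (move x w) = length x"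
  by (induction w arbitrary: x) auto

lemma move_in_cube [simp]: "move x w \<in> cube_verts n \<longleftrightarrow> x \<in> cube_verts n"
  by (simp add: cube_verts_def)

lemma move_nth:
  "distinct w \<Longrightarrow> k < length x \<Longrightarrow> move x w ! k = (x ! k \<noteq> (k \<in> set w))"
proof (induction w arbitrary: x)
  case (Cons i w)
  then have "move x (i # w) ! k = (flip x i ! k \<noteq> (k \<in> set w))" by simp
  then show ?case using Cons.prems by (cases "k = i") (auto simp: flip_def)
qed simp

lemma sum_cube_move: "(\<Sum>x\<in>cube_verts n. f (move x w)) = (\<Sum>x\<in>cube_verts n. f x)"
  by (induction w) (simp_all add: sum_cube_flip[where f = "\<lambda>x. f (move x _)"])

lemma cols_append: "cols c x (u @ v) = cols c x u @ cols c (move x u) v"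
  by (induction u arbitrary: x) auto

lemma length_cols [simp]: "length (cols c x w) = length w"
  by (induction w arbitrary: x) auto

lemma cols_nth: "k < length w \<Longrightarrow> cols c x w ! k = col c (move x (take k w)) (w ! k)"
  by (induction w arbitrary: x k) (auto simp: nth_Cons split: nat.splits)

fun reorder :: "(bool list set \<Rightarrow> bool) \<Rightarrow> bool list \<Rightarrow> bool \<Rightarrow> nat list \<Rightarrow> nat list" where
  "reorder c x z (i # j # w) =
     (if square c (swaps z) x i j then [j, i] else [i, j]) @
     reorder c (far x i j) (step_last c x z i j) w"
| "reorder c x z w = w"

lemma mset_reorder: "mset (reorder c x z w) = mset w"
  by (induction c x z w rule: reorder.induct) auto

text \<open>Distinctness rules out degenerate blocks, and evenness a last unpaired direction;
  \<open>block_cost\<close> charges nothing for either.\<close>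

lemma chg_reorder:
  "even (length w) \<Longrightarrow> distinct w \<Longrightarrow>
   real (chg (z # cols c x (reorder c x z w))) = block_cost c x z w"
proof (induction c x z w rule: reorder.induct)
  case (1 c x z i j w)
  have far: "flip (flip x j) i = far x i j" "flip (flip x i) j = far x i j"
    by (simp_all add: far_def flip_commute)
  have "step_cost c x z i j =
      of_bool (z \<noteq> (if square c (swaps z) x i j then col c x j else col c x i)) +
      of_bool ((if square c (swaps z) x i j then col c x j else col c x i) \<noteq> step_last c x z i j)"
    using swaps_cost[of z "col c x i" "col c (flip x i) j" "col c x j" "col c (flip x j) i"] 1(3)
    by (simp add: step_cost_def inner_at_def start_at_def square_def step_last_def)
  moreover have "real (chg (step_last c x z i j #
      cols c (far x i j) (reorder c (far x i j) (step_last c x z i j) w))) =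
      block_cost c (far x i j) (step_last c x z i j) w"
    using 1 by simp
  ultimately show ?case
    using 1(3) by (auto simp: far step_last_def)
qed auto

text \<open>The colour before a segment is fictitious: averaging over its two values removes the
  sign term, and one of the values does no worse than the average.\<close>

definition segment_cost :: "(bool list set \<Rightarrow> bool) \<Rightarrow> bool list \<Rightarrow> nat list \<Rightarrow> real" where
  "segment_cost c x w = (block_cost c x True w + block_cost c x False w) / 2"

lemma segment_cost_nonneg: "0 \<le> segment_cost c x w"
  by (simp add: segment_cost_def block_cost_nonneg)

lemma segment_reorder:
  assumes "even (length w)" "distinct w"
  obtains w' where "mset w' = mset w" "real (chg (cols c x w')) \<le> segment_cost c x w"
proof -
  obtain z where z: "block_cost c x z w \<le> segment_cost c x w"
  proof (cases "block_cost c x True w \<le> block_cost c x False w")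
    case True
    then show ?thesis by (intro that[of True]) (simp add: segment_cost_def)
  next
    case False
    then show ?thesis by (intro that[of False]) (simp add: segment_cost_def)
  qed
  have "real (chg (cols c x (reorder c x z w))) \<le> real (chg (z # cols c x (reorder c x z w)))"
    by (simp only: of_nat_le_iff chg_le_Cons)
  with chg_reorder[OF assms, of z c x] z show ?thesis
    by (intro that[of "reorder c x z w"]) (simp_all add: mset_reorder)
qed

text \<open>A reordered segment still ends at the same vertex, so segments can be treated
  independently. Each of the \<open>m\<close> gluings adds at most 1, and so does each direction
  left over after the last full segment.\<close>

lemma segments_reorder:
  assumes "even K" "distinct w" "m * K \<le> length w"
  shows "\<exists>w'. mset w' = mset w \<and> real (chg (cols c x w')) \<le>
    (\<Sum>s<m. segment_cost c (move x (take (s * K) w)) (take K (drop (s * K) w))) +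
    real m + real (length w - m * K)"
  using assms(2,3)
proof (induction m arbitrary: x w)
  case 0
  show ?case using chg_le_length[of "cols c x w"] by (intro exI[of _ w]) simp
next
  case (Suc m)
  define u v where "u = take K w" and "v = drop K w"
  have K: "K \<le> length w" using Suc.prems by simp
  have w: "w = u @ v" "length u = K" "length v = length w - K"
    using K by (auto simp: u_def v_def)
  obtain u' where u': "mset u' = mset u" "real (chg (cols c x u')) \<le> segment_cost c x u"
  proof (rule segment_reorder[of u c x])
    show "even (length u)" "distinct u"
      using Suc.prems(1) assms(1) w(2) by (simp_all add: u_def)
  qed
  obtain v' where v': "mset v' = mset v" "real (chg (cols c (move x u) v')) \<le>
    (\<Sum>s<m. segment_cost c (move (move x u) (take (s * K) v)) (take K (drop (s * K) v))) +
    real m + real (length v - m * K)"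
  proof -
    have "distinct v" "m * K \<le> length v"
      using Suc.prems by (simp_all add: v_def)
    then show ?thesis using Suc.IH[of v "move x u"] that by blast
  qed
  have "move (move x u) (take (s * K) v) = move x (take (Suc s * K) w)"
    "drop (s * K) v = drop (Suc s * K) w" for s
    by (simp_all add: w(1) move_append[symmetric] w(2))
  moreover have "length v - m * K = length w - Suc m * K" using w by simp
  ultimately have v'': "real (chg (cols c (move x u) v')) \<le>
    (\<Sum>s<m. segment_cost c (move x (take (Suc s * K) w)) (take K (drop (Suc s * K) w))) +
    real m + real (length w - Suc m * K)"
    using v'(2) by simp
  have "real (chg (cols c x (u' @ v'))) \<le>
      real (chg (cols c x u')) + real (chg (cols c (move x u) v')) + 1"
    using chg_append_le[of "cols c x u'" "cols c (move x u) v'"] move_mset[OF u'(1)]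
    by (simp add: cols_append)
  also have "\<dots> \<le> (\<Sum>s<Suc m. segment_cost c (move x (take (s * K) w)) (take K (drop (s * K) w))) +
    real (Suc m) + real (length w - Suc m * K)"
    using u'(2) v'' unfolding sum.lessThan_Suc_shift by (simp add: u_def)
  finally show ?case using u'(1) v'(1) w(1) by (intro exI[of _ "u' @ v'"]) simp
qed

section \<open>From random permutations to independent directions\<close>

text \<open>Rotation by \<open>a\<close> is a bijection on permutations and brings the window to the
  front.\<close>

lemma sum_permutations_take_drop:
  assumes "a + k \<le> n"
  shows "(\<Sum>w\<in>permutations_of_set {..<n}. f (take k (drop a w))) =
    (\<Sum>w\<in>permutations_of_set {..<n}. f (take k w))"
proof -
  have len: "length w = n" if "w \<in> permutations_of_set {..<n}" for w
    using length_finite_permutations_of_set[OF that] by simp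
  show ?thesis
  proof (rule sum.reindex_bij_witness[where j = "rotate a" and i = "rotate (n - a)"])
    fix w assume w: "w \<in> permutations_of_set {..<n}"
    show "rotate (n - a) (rotate a w) = w" "rotate a (rotate (n - a) w) = w"
      using assms len[OF w] by (simp_all add: rotate_rotate)
    show "rotate a w \<in> permutations_of_set {..<n}" "rotate (n - a) w \<in> permutations_of_set {..<n}"
      using w by (auto simp: permutations_of_set_def)
    show "f (take k (rotate a w)) = f (take k (drop a w))"
    \<comment> \<open>Rotation works modulo the length, so \<open>a = n\<close> is separate; the
      window is then empty.\<close>
    proof (cases "a = n")
      case True
      with assms show ?thesis by simp
    next
      case False
      with assms len[OF w] show ?thesis by (simp add: rotate_drop_take)
    qed
  qed
qed

text \<open>A distinct word is a prefix of at most \<open>fact (n - k)\<close> permutations, any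
  other word of none; nonnegativity lets the sum run over all words.\<close>

lemma sum_permutations_take_le:
  fixes f :: "nat list \<Rightarrow> real"
  assumes "k \<le> n" and f: "\<And>u. 0 \<le> f u"
  shows "(\<Sum>w\<in>permutations_of_set {..<n}. f (take k w)) \<le> fact (n - k) * (\<Sum>u\<in>words n k. f u)"
proof -
  let ?P = "permutations_of_set {..<n}"
  have len: "length w = n" if "w \<in> ?P" for w
    using length_finite_permutations_of_set[OF that] by simp
  have "(\<Sum>w\<in>?P. f (take k w)) = (\<Sum>u\<in>words n k. \<Sum>w\<in>{w \<in> ?P. take k w = u}. f (take k w))"
  proof (rule sum.group[symmetric])
    have "take k w \<in> words n k" if "w \<in> ?P" for w
      using that len[OF that] assms(1) set_take_subset[of k w]
      by (auto simp: words_def permutations_of_set_def)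
    then show "take k ` ?P \<subseteq> words n k" by blast
  qed simp_all
  also have "\<dots> = (\<Sum>u\<in>words n k. real (card {w \<in> ?P. take k w = u}) * f u)"
    by (intro sum.cong refl) simp
  also have "\<dots> \<le> (\<Sum>u\<in>words n k. fact (n - k) * f u)"
  proof (intro sum_mono mult_right_mono f)
    fix u assume u: "u \<in> words n k"
    have "card {w \<in> ?P. take k w = u} \<le> fact (n - k)"
    proof (cases "distinct u")
      case True
      have "{w \<in> ?P. take k w = u} \<subseteq> (\<lambda>v. u @ v) ` permutations_of_set ({..<n} - set u)"
      proof
        fix w assume w: "w \<in> {w \<in> ?P. take k w = u}"
        then have "w = u @ drop k w" by (metis (mono_tags) append_take_drop_id mem_Collect_eq)
        moreover have "set w = {..<n}" "distinct w"
          using w by (auto simp: permutations_of_set_def)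
        ultimately have "set u \<union> set (drop k w) = {..<n}" "set u \<inter> set (drop k w) = {}"
          "distinct (drop k w)"
          by (metis set_append) (metis \<open>distinct w\<close> \<open>w = u @ drop k w\<close> distinct_append)+
        then have "drop k w \<in> permutations_of_set ({..<n} - set u)"
          by (auto simp: permutations_of_set_def)
        moreover note \<open>w = u @ drop k w\<close>
        ultimately show "w \<in> (\<lambda>v. u @ v) ` permutations_of_set ({..<n} - set u)" by blast
      qed
      then have "card {w \<in> ?P. take k w = u} \<le> card (permutations_of_set ({..<n} - set u))"
        by (meson card_image_le card_mono finite_imageI finite_permutations_of_set le_trans)
      also have "card ({..<n} - set u) = n - k"
        using u True by (subst card_Diff_subset) (auto simp: words_def distinct_card)
      then have "card (permutations_of_set ({..<n} - set u)) = fact (n - k)" by simp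
      finally show ?thesis .
    next
      case False
      have "distinct (take k w)" if "w \<in> ?P" for w
        using that by (simp add: permutations_of_set_def)
      with False have "{w \<in> ?P. take k w = u} = {}" by blast
      then show ?thesis by (simp only: card.empty)
    qed
    then show "real (card {w \<in> ?P. take k w = u}) \<le> fact (n - k)"
      by (metis of_nat_fact of_nat_le_iff)
  qed
  finally show ?thesis by (simp add: sum_distrib_left)
qed

lemma power_mult_fact_le: "real m ^ k * fact m \<le> fact (m + k)"
proof (induction k)
  case (Suc k)
  have "real m ^ Suc k * fact m = real m * (real m ^ k * fact m)" by simp
  also have "\<dots> \<le> real (Suc (m + k)) * fact (m + k)"
    by (intro mult_mono Suc) auto
  finally show ?case by (simp add: fact_Suc)
qed simp

text \<open>First moment argument over start vertices and permutations. A segment costs at most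
  \<open>3 / 4 * L\<close> on average, up to the factor \<rho>, and there are at most
  \<open>n / (2 * L)\<close> segments, which gives 3/8.\<close>

lemma few_changes:
  assumes "L > 0" "2 * L < n"
  obtains x w where "x \<in> cube_verts n" "w \<in> permutations_of_set {..<n}"
    "real (chg (cols c x w)) \<le>
      real n * (3 / 8 * (real n / (real n - 2 * real L)) ^ (2 * L) + 1 / (2 * real L)) + 2 * real L"
proof -
  define K where "K = 2 * L"
  define m where "m = n div K"
  define P where "P = permutations_of_set {..<n}"
  define T where "T x w = (\<Sum>s<m. segment_cost c (move x (take (s * K) w)) (take K (drop (s * K) w)))"
    for x w
  \<comment> \<open>An upper bound for \<open>n ^ K * fact (n - K) / fact n\<close>, the price of
    drawing with replacement.\<close>
  define \<rho> where "\<rho> = (real n / real (n - K)) ^ K"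
  have K: "even K" "0 < K" "K < n" using assms by (auto simp: K_def)
  have mK: "m * K \<le> n" by (simp add: m_def)
  have len: "length w = n" if "w \<in> P" for w
    using length_finite_permutations_of_set[OF that[unfolded P_def]] by simp
  have finP: "finite P" and cardP: "card P = fact n" by (simp_all add: P_def)
  have one: "(\<Sum>w\<in>P. \<Sum>x\<in>cube_verts n. segment_cost c (move x (take (s * K) w)) (take K (drop (s * K) w)))
      \<le> fact n * 2 ^ n * (3 / 4 * real L * \<rho>)" if "s < m" for s
  proof -
    have "Suc s * K \<le> n" using that mK by (meson Suc_leI le_trans mult_le_mono1)
    then have sK: "s * K + K \<le> n" by simp
    define f where "f u = (\<Sum>x\<in>cube_verts n. segment_cost c x u)" for u
    \<comment> \<open>Moving along the earlier segments permutes the cube, so \<open>move\<close>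
      disappears from the sum over \<open>x\<close>.\<close>
    have "(\<Sum>w\<in>P. \<Sum>x\<in>cube_verts n. segment_cost c (move x (take (s * K) w)) (take K (drop (s * K) w)))
        = (\<Sum>w\<in>P. f (take K (drop (s * K) w)))"
      unfolding f_def by (simp add: sum_cube_move[where f = "\<lambda>x. segment_cost c x _"])
    also have "\<dots> = (\<Sum>w\<in>P. f (take K w))"
      unfolding P_def by (rule sum_permutations_take_drop[OF sK])
    also have "\<dots> \<le> fact (n - K) * (\<Sum>u\<in>words n K. f u)"
      unfolding P_def using K by (intro sum_permutations_take_le) (auto simp: f_def segment_cost_nonneg sum_nonneg)
    also have "(\<Sum>u\<in>words n K. f u) \<le> 3 / 4 * real L * 2 ^ n * real n ^ K"
    proof -
      have "(\<Sum>u\<in>words n K. f u) =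
          (\<Sum>x\<in>cube_verts n. \<Sum>u\<in>words n K. block_cost c x True u + block_cost c x False u) / 2"
        unfolding f_def segment_cost_def by (subst sum.swap) (simp only: sum_divide_distrib)
      with sum_block_cost_le[of n c L] K show ?thesis by (simp add: K_def)
    qed
    also have "fact (n - K) * (3 / 4 * real L * 2 ^ n * real n ^ K) =
        (real (n - K) ^ K * fact (n - K)) * 2 ^ n * (3 / 4 * real L * \<rho>)"
      using K by (simp add: \<rho>_def power_divide)
    also have "\<dots> \<le> fact n * 2 ^ n * (3 / 4 * real L * \<rho>)"
      using power_mult_fact_le[of "n - K" K] K by (intro mult_right_mono) (auto simp: \<rho>_def)
    finally show ?thesis by (simp add: mult_left_mono)
  qed
  have total: "(\<Sum>(x, w)\<in>cube_verts n \<times> P. T x w) \<le> fact n * 2 ^ n * (real m * (3 / 4 * real L * \<rho>))"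
  proof -
    have "(\<Sum>(x, w)\<in>cube_verts n \<times> P. T x w) = (\<Sum>s<m. \<Sum>w\<in>P. \<Sum>x\<in>cube_verts n.
        segment_cost c (move x (take (s * K) w)) (take K (drop (s * K) w)))"
      unfolding T_def sum.cartesian_product[symmetric]
      by (subst sum.swap, subst (2) sum.swap, subst sum.swap, rule refl)
    also have "\<dots> \<le> (\<Sum>s<m. fact n * 2 ^ n * (3 / 4 * real L * \<rho>))"
      by (intro sum_mono one) simp
    finally show ?thesis by (simp add: mult_ac)
  qed
  have "\<exists>x\<in>cube_verts n. \<exists>w\<in>P. T x w \<le> real m * (3 / 4 * real L * \<rho>)"
  proof (rule ccontr)
    assume "\<not> ?thesis"
    then have "(\<Sum>q\<in>cube_verts n \<times> P. real m * (3 / 4 * real L * \<rho>)) < (\<Sum>(x, w)\<in>cube_verts n \<times> P. T x w)"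
    proof (intro sum_strict_mono)
      have "card (cube_verts n \<times> P) \<noteq> 0" by (simp add: card_cartesian_product cardP)
      then show "cube_verts n \<times> P \<noteq> {}" by fastforce
    qed (auto simp: finP not_le)
    then show False using total by (simp add: card_cartesian_product cardP mult_ac)
  qed
  then obtain x w where xw: "x \<in> cube_verts n" "w \<in> P" "T x w \<le> real m * (3 / 4 * real L * \<rho>)"
    by blast
  obtain w' where w': "mset w' = mset w" "real (chg (cols c x w')) \<le> T x w + real m + real (n - m * K)"
    using segments_reorder[OF K(1), of w m c x] xw(2) mK len[OF xw(2)]
    by (auto simp: T_def P_def permutations_of_set_def)
  have "w' \<in> permutations_of_set {..<n}"
    using w'(1) xw(2) mset_eq_imp_distinct_iff[OF w'(1)] mset_eq_setD[OF w'(1)]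
    by (auto simp: P_def permutations_of_set_def)
  moreover have "real (chg (cols c x w')) \<le>
      real n * (3 / 8 * (real n / (real n - 2 * real L)) ^ (2 * L) + 1 / (2 * real L)) + 2 * real L"
  proof -
    have \<rho>: "\<rho> = (real n / (real n - 2 * real L)) ^ (2 * L)"
      using K by (simp add: \<rho>_def K_def of_nat_diff)
    have "0 \<le> \<rho>" by (simp add: \<rho>_def)
    have "n - m * K \<le> K"
      using K(2) by (simp add: m_def minus_div_mult_eq_mod less_imp_le)
    then have "real (n - m * K) \<le> 2 * real L"
      unfolding K_def by linarith
    moreover have "real m * (2 * real L) \<le> real n"
      using mK by (metis K_def of_nat_mult of_nat_numeral of_nat_le_iff)
    then have m: "real m \<le> real n / (2 * real L)" using assms by (simp add: field_simps)
    then have "real m * (3 / 4 * real L * \<rho>) \<le> real n / (2 * real L) * (3 / 4 * real L * \<rho>)"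
      using \<open>0 \<le> \<rho>\<close> by (intro mult_right_mono) auto
    then have "real m * (3 / 4 * real L * \<rho>) \<le> real n * (3 / 8 * \<rho>)"
      using assms by simp
    ultimately have "real (chg (cols c x w')) \<le>
        real n * (3 / 8 * \<rho>) + real n / (2 * real L) + 2 * real L"
      using w'(2) xw(3) m by linarith
    then show ?thesis by (simp add: \<rho> distrib_left)
  qed
  ultimately show ?thesis using that xw(1) by blast
qed

lemma eventually_few_changes:
  assumes "0 < \<delta>"
  shows "\<forall>\<^sub>F n in sequentially. \<forall>c. \<exists>x\<in>cube_verts n. \<exists>w\<in>permutations_of_set {..<n}.
    real (chg (cols c x w)) \<le> (3 / 8 + \<delta>) * real n"
proof -
  \<comment> \<open>\<open>L\<close> is fixed first, to push the gluing term below \<delta> / 2; the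
    remaining errors vanish as \<open>n\<close> grows.\<close>
  obtain L :: nat where L: "1 / \<delta> < real L" using reals_Archimedean2 by blast
  have Lpos: "0 < real L" using L assms by (meson less_trans zero_less_divide_1_iff)
  then have half: "1 / (2 * real L) < \<delta> / 2" using L assms by (simp add: field_simps)
  have "(\<lambda>n. real n / (real n - 2 * real L)) \<longlonglongrightarrow> 1" by real_asymp
  then have "(\<lambda>n. 3 / 8 * (real n / (real n - 2 * real L)) ^ (2 * L)) \<longlonglongrightarrow> 3 / 8 * 1 ^ (2 * L)"
    by (intro tendsto_intros)
  moreover have "(\<lambda>n. 2 * real L / real n) \<longlonglongrightarrow> 0" by real_asymp
  ultimately have "(\<lambda>n. 3 / 8 * (real n / (real n - 2 * real L)) ^ (2 * L) + 2 * real L / real n) \<longlonglongrightarrow>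
      3 / 8 * 1 ^ (2 * L) + 0"
    by (rule tendsto_add)
  then have "\<forall>\<^sub>F n in sequentially.
      3 / 8 * (real n / (real n - 2 * real L)) ^ (2 * L) + 2 * real L / real n < 3 / 8 + \<delta> / 2"
    by (rule order_tendstoD(2)) (use assms in simp)
  then show ?thesis
    using eventually_gt_at_top[of "2 * L"]
  proof eventually_elim
    case (elim n)
    show ?case
    proof
      fix c
      obtain x w where xw: "x \<in> cube_verts n" "w \<in> permutations_of_set {..<n}"
        "real (chg (cols c x w)) \<le>
          real n * (3 / 8 * (real n / (real n - 2 * real L)) ^ (2 * L) + 1 / (2 * real L)) + 2 * real L"
        using few_changes[of L n c] Lpos elim by auto
      note xw(3)
      also have "real n * (3 / 8 * (real n / (real n - 2 * real L)) ^ (2 * L) + 1 / (2 * real L)) + 2 * real L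
          = real n * ((3 / 8 * (real n / (real n - 2 * real L)) ^ (2 * L) + 2 * real L / real n) + 1 / (2 * real L))"
        using elim by (simp add: distrib_left)
      also have "\<dots> \<le> real n * (3 / 8 + \<delta>)"
        using elim half by (intro mult_left_mono) auto
      finally show "\<exists>x\<in>cube_verts n. \<exists>w\<in>permutations_of_set {..<n}.
          real (chg (cols c x w)) \<le> (3 / 8 + \<delta>) * real n"
        using xw by (auto simp: mult.commute)
    qed
  qed
qed

subsection \<open>Geodesics from direction sequences\<close>

primrec verts :: "bool list \<Rightarrow> nat list \<Rightarrow> bool list list" where
  "verts x [] = [x]"
| "verts x (i # w) = x # verts (flip x i) w"

lemma length_verts [simp]: "length (verts x w) = Suc (length w)"
  by (induction w arbitrary: x) auto

lemma verts_nth: "k \<le> length w \<Longrightarrow> verts x w ! k = move x (take k w)"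
  by (induction w arbitrary: x k) (auto simp: nth_Cons split: nat.splits)

lemma verts_joins: "path_joins (verts x w) x (move x w)"
proof -
  have "verts x w \<noteq> []" by (cases w) auto
  then show ?thesis
    by (simp add: path_joins_def hd_conv_nth last_conv_nth verts_nth)
qed

lemma verts_nth_Suc:
  "k < length w \<Longrightarrow> verts x w ! Suc k = flip (verts x w ! k) (w ! k)"
  by (simp add: verts_nth take_Suc_conv_app_nth move_append)

lemma flip_differs: "i < length x \<Longrightarrow> j < length x \<Longrightarrow> x ! j \<noteq> flip x i ! j \<longleftrightarrow> j = i"
  by (auto simp: flip_def nth_list_update)

lemma flip_edge:
  assumes "x \<in> cube_verts n" "i < n"
  shows "{x, flip x i} \<in> cube_edges n" "cube_direction n {x, flip x i} = i"
proof -
  have x: "length x = n" using assms by (simp add: cube_verts_def)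
  have d: "x ! j \<noteq> flip x i ! j \<longleftrightarrow> j = i" if "j < n" for j
    using flip_differs[of i x j] assms(2) that x by blast
  then have u: "\<exists>!j. j < n \<and> x ! j \<noteq> flip x i ! j"
    using assms(2) by blast
  then show "{x, flip x i} \<in> cube_edges n"
    using assms(1) unfolding cube_edges_def by (intro CollectI exI[of _ x] exI[of _ "flip x i"]) simp
  show "cube_direction n {x, flip x i} = i"
    using cube_direction_edge[OF u assms(2)] d[OF assms(2)] by blast
qed

lemma verts_geodesic:
  assumes "x \<in> cube_verts n" "distinct w" "set w \<subseteq> {..<n}"
  shows "cube_geodesic n (verts x w)"
proof -
  let ?p = "verts x w"
  have x: "length x = n" using assms by (simp add: cube_verts_def)
  have w: "w ! k < n" if "k < length w" for k
    using assms(3) that by (meson lessThan_iff nth_mem subsetD)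
  have vert: "?p ! k \<in> cube_verts n" if "k \<le> length w" for k
    using that assms(1) by (simp add: verts_nth)
  have edge: "{?p ! k, ?p ! Suc k} \<in> cube_edges n" "cube_direction n {?p ! k, ?p ! Suc k} = w ! k"
    if "k < length w" for k
    using flip_edge[OF vert[of k] w[OF that]] that by (simp_all add: verts_nth_Suc)
  \<comment> \<open>Coordinate \<open>w ! i\<close> is flipped in step \<open>i\<close> and never
    again, so it separates the two vertices.\<close>
  have neq: "?p ! i \<noteq> ?p ! j" if "i < j" "j \<le> length w" for i j
  proof
    assume eq: "?p ! i = ?p ! j"
    have "w ! i \<in> set (take j w)" "w ! i \<notin> set (take i w)"
      using that assms(2) by (auto simp: in_set_conv_nth nth_eq_iff_index_eq)
    moreover have "?p ! k ! (w ! i) = (x ! (w ! i) \<noteq> (w ! i \<in> set (take k w)))" if "k \<le> length w" for k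
      using that \<open>i < j\<close> \<open>j \<le> length w\<close> w[of i] x assms(2) by (simp add: verts_nth move_nth)
    from this[of i] this[of j] have
      "(x ! (w ! i) \<noteq> (w ! i \<in> set (take i w))) = (x ! (w ! i) \<noteq> (w ! i \<in> set (take j w)))"
      using eq that by simp
    ultimately show False by blast
  qed
  have "distinct ?p"
    unfolding distinct_conv_nth
  proof (intro allI impI)
    fix i j assume "i < length ?p" "j < length ?p" "i \<noteq> j"
    then show "?p ! i \<noteq> ?p ! j"
      using neq[of i j] neq[of j i] by (cases "i < j") auto
  qed
  moreover have "?p \<noteq> []" by (cases w) auto
  moreover have "set ?p \<subseteq> cube_verts n"
    using vert by (auto simp: in_set_conv_nth)
  ultimately have "graph_path (cube_verts n) (cube_edges n) ?p"
    unfolding graph_path_def using edge(1) by simp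
  then show ?thesis
    unfolding cube_geodesic_def using edge(2) assms(2) by (simp add: nth_eq_iff_index_eq)
qed

lemma colour_changes_verts: "colour_changes c (verts x w) = chg (cols c x w)"
proof -
  let ?p = "verts x w"
  have cols: "cols c x w ! k = c {?p ! k, ?p ! Suc k}" if "k < length w" for k
    using that by (simp add: cols_nth col_def verts_nth_Suc) (simp add: verts_nth)
  let ?S = "{k. Suc k < length (cols c x w) \<and> cols c x w ! k \<noteq> cols c x w ! Suc k}"
  \<comment> \<open>Interior vertex \<open>i\<close> lies between the edges \<open>i - 1\<close> and
    \<open>i\<close>, hence the shift by \<open>Suc\<close>.\<close>
  have "{i. 1 \<le> i \<and> i + 1 < length ?p \<and> c {?p ! (i - 1), ?p ! i} \<noteq> c {?p ! i, ?p ! (i + 1)}} = Suc ` ?S"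
  proof (rule set_eqI)
    fix i
    show "i \<in> {i. 1 \<le> i \<and> i + 1 < length ?p \<and> c {?p ! (i - 1), ?p ! i} \<noteq> c {?p ! i, ?p ! (i + 1)}} \<longleftrightarrow>
        i \<in> Suc ` ?S"
      by (cases i) (auto simp: cols)
  qed
  then show ?thesis
    by (simp add: colour_changes_def chg_eq_card card_image)
qed

text \<open>Each edge changes a single coordinate. This supplies the lower bound on the distance of
  opposite corners.\<close>

lemma cube_path_differences:
  assumes "graph_path (cube_verts n) (cube_edges n) p" "k < length p"
  shows "card {i. i < n \<and> p ! 0 ! i \<noteq> p ! k ! i} \<le> k"
  using assms(2)
proof (induction k)
  case (Suc k)
  let ?D = "\<lambda>k. {i. i < n \<and> p ! 0 ! i \<noteq> p ! k ! i}"
  have "{p ! k, p ! Suc k} \<in> cube_edges n"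
    using assms(1) Suc.prems by (simp add: graph_path_def)
  then obtain x y where xy: "{p ! k, p ! Suc k} = {x, y}" "\<exists>!i. i < n \<and> x ! i \<noteq> y ! i"
    unfolding cube_edges_def by blast
  from xy(2) obtain j where j: "\<And>i. i < n \<Longrightarrow> x ! i \<noteq> y ! i \<Longrightarrow> i = j"
    by (metis ex1_implies_ex)
  have "p ! k ! i = p ! Suc k ! i" if "i < n" "i \<noteq> j" for i
    using xy(1) j[OF that(1)] that(2) by (auto simp: doubleton_eq_iff)
  then have "?D (Suc k) \<subseteq> insert j (?D k)" by auto
  then have "card (?D (Suc k)) \<le> card (insert j (?D k))" by (intro card_mono) auto
  also have "\<dots> \<le> Suc (card (?D k))" by (rule card_insert_le_m1) simp_all
  also have "\<dots> \<le> Suc k" using Suc by simp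
  finally show ?case .
qed simp

lemma move_antipodal:
  assumes "x \<in> cube_verts n" "w \<in> permutations_of_set {..<n}"
  shows "cube_antipodal n x (move x w)"
proof -
  have w: "distinct w" "set w = {..<n}" "length w = n"
    using assms(2) length_finite_permutations_of_set[OF assms(2)]
    by (auto simp: permutations_of_set_def)
  have x: "length x = n" using assms(1) by (simp add: cube_verts_def)
  have "graph_dist (cube_verts n) (cube_edges n) x (move x w) = enat n"
    unfolding graph_dist_def
  proof (rule antisym)
    have "graph_path (cube_verts n) (cube_edges n) (verts x w)"
      using verts_geodesic[OF assms(1) w(1)] w(2) by (simp add: cube_geodesic_def)
    then show "(INF p\<in>{p. graph_path (cube_verts n) (cube_edges n) p \<and> path_joins p x (move x w)}.
        enat (length p - 1)) \<le> enat n"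
      by (intro INF_lower2[of "verts x w"]) (auto simp: verts_joins w(3))
  next
    show "enat n \<le> (INF p\<in>{p. graph_path (cube_verts n) (cube_edges n) p \<and> path_joins p x (move x w)}.
        enat (length p - 1))"
    proof (rule INF_greatest)
      fix p assume p: "p \<in> {p. graph_path (cube_verts n) (cube_edges n) p \<and> path_joins p x (move x w)}"
      then have ne: "p \<noteq> []" by (simp add: graph_path_def)
      then have ends: "p ! 0 = x" "p ! (length p - 1) = move x w"
        using p by (simp_all add: path_joins_def hd_conv_nth last_conv_nth)
      have "x ! i \<noteq> move x w ! i" if "i < n" for i
        using move_nth[of w i x] that w x by simp
      then have "{i. i < n \<and> x ! i \<noteq> move x w ! i} = {..<n}" by blast
      then show "enat n \<le> enat (length p - 1)"
        using cube_path_differences[of n p "length p - 1"] p ne ends by simp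
    qed
  qed
  then show ?thesis using assms(1) by (simp add: cube_antipodal_def)
qed


lemma geodesic_from_word:
  assumes "x \<in> cube_verts n" "w \<in> permutations_of_set {..<n}" "real (chg (cols c x w)) \<le> b"
  shows "\<exists>u v p. cube_antipodal n u v \<and> cube_geodesic n p \<and> path_joins p u v \<and>
    real (colour_changes c p) \<le> b"
proof -
  have "cube_geodesic n (verts x w)"
    using assms(1,2) by (intro verts_geodesic) (auto simp: permutations_of_set_def)
  then show ?thesis
    using move_antipodal[OF assms(1,2)] verts_joins[of x w] assms(3)
    by (metis colour_changes_verts)
qed

text \<open>Diagonal choice: for each \<open>n\<close> take the least admissible
  \<open>1 / (j + 1)\<close> with \<open>j \<le> n\<close>. The cut-off at \<open>n\<close> makes
  the maximum exist, and \<open>j = 0\<close> is always admissible by \<open>one\<close>.\<close>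

lemma exists_vanishing_error:
  fixes P :: "nat \<Rightarrow> real \<Rightarrow> bool"
  assumes one: "\<And>n. P n 1" and ev: "\<And>\<delta>. 0 < \<delta> \<Longrightarrow> \<forall>\<^sub>F n in sequentially. P n \<delta>"
  shows "\<exists>\<epsilon>. (\<forall>n. 0 \<le> \<epsilon> n) \<and> \<epsilon> \<longlonglongrightarrow> 0 \<and> (\<forall>n. P n (\<epsilon> n))"
proof -
  define S where "S n = {j. j \<le> n \<and> P n (1 / real (Suc j))}" for n
  define \<epsilon> where "\<epsilon> n = 1 / real (Suc (Max (S n)))" for n
  have fin: "finite (S n)" and zero: "0 \<in> S n" for n
    using one by (auto simp: S_def)
  have "Max (S n) \<in> S n" for n
    using fin zero by (intro Max_in) auto
  then have P: "P n (\<epsilon> n)" for n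
    by (simp add: S_def \<epsilon>_def)
  have nonneg: "0 \<le> \<epsilon> n" for n by (simp add: \<epsilon>_def)
  have "\<forall>\<^sub>F n in sequentially. \<bar>\<epsilon> n\<bar> < e" if e: "0 < e" for e
  proof -
    obtain j where j: "1 / real (Suc j) < e" using nat_approx_posE[OF e] by blast
    show ?thesis
      using ev[of "1 / real (Suc j)"] eventually_ge_at_top[of j]
    proof (rule eventually_elim2)
      fix n assume "P n (1 / real (Suc j))" "j \<le> n"
      then have "j \<le> Max (S n)" using fin[of n] by (intro Max_ge) (auto simp: S_def)
      then have "\<epsilon> n \<le> 1 / real (Suc j)" by (simp add: \<epsilon>_def frac_le)
      then show "\<bar>\<epsilon> n\<bar> < e" using j nonneg[of n] by linarith
    qed simp
  qed
  then have "\<epsilon> \<longlonglongrightarrow> 0" by (simp add: tendsto_iff dist_real_def)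
  with nonneg P show ?thesis by blast
qed

theorem theorem5:
  shows "\<exists>\<epsilon> :: nat \<Rightarrow> real. (\<forall>n. 0 \<le> \<epsilon> n) \<and> \<epsilon> \<longlonglongrightarrow> 0 \<and>
    (\<forall>n. \<forall>c :: bool list set \<Rightarrow> bool. \<exists>u v p.
       cube_antipodal n u v \<and> cube_geodesic n p \<and> path_joins p u v \<and>
       real (colour_changes c p) \<le> (3 / 8 + \<epsilon> n) * real n)"
proof (rule exists_vanishing_error, goal_cases)
  case (1 n)
  show ?case
  proof (intro allI geodesic_from_word)
    fix c :: "bool list set \<Rightarrow> bool"
    \<comment> \<open>With error 1 any antipodal geodesic will do, since it has at most
      \<open>n\<close> changes.\<close>
    show "replicate n False \<in> cube_verts n" "[0..<n] \<in> permutations_of_set {..<n}"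
      by (auto simp: cube_verts_def permutations_of_set_def)
    have "chg (cols c (replicate n False) [0..<n]) \<le> n"
      using chg_le_length[of "cols c (replicate n False) [0..<n]"] by simp
    then show "real (chg (cols c (replicate n False) [0..<n])) \<le> (3 / 8 + 1) * real n" by simp
  qed
next
  case (2 \<delta>)
  from eventually_few_changes[OF this] show ?case
    by eventually_elim (meson geodesic_from_word)
qed

end
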